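(* In the setting of the convex problem $\inf_{x\in X} f(x)$ subject to $C(x)\in K$ described in the context, let $(x^k,y^k,\lambda^k,s^k)_{k}$ be a sequence generated by the inexact augmented Lagrangian method (IALM) with errors $(\varepsilon_k)_{k\ge1}$ and penalty parameters $(\gamma_k)_{k\ge0}$ satisfying the error and step-size conditions. The algorithm simply converges to the closest feasible problem if and only if the value function $\nu$ is lower semicontinuous and finite at $\bar s$. If furthermore the closest feasible problem has finite value (i.e., $\nu(\bar s)<\infty$), then the algorithm semi-quantitatively converges to the closest feasible problem.
   Context: Setting. $X$ is a nonempty closed convex subset of a real Hilbert space, $Y$ is a real Hilbert space, $K\subseteq Y$ is nonempty, closed and convex, $f:X\to\mathbb{R}\cup\{+\infty\}$ is closed (lower semicontinuous), proper and convex, and $C:X\to Y$ is a mapping such that $\mathcal{C}=\{(x,s)\in X\times Y: s\in C(x)-K\}$ is closed, convex and nonempty. The problem may be infeasible. The value function is $\nu(s)=\inf\{f(x): x\in X,\ C(x)\in K+s\}$ for $s\in Y$; it is assumed throughout that $\nu$ is proper, i.e. $\nu(s)>-\infty$ for all $s$. The set of attainable constraint violations is $\mathcal{S}=\{s\in Y:\exists x\in X,\ (x,s)\in\mathcal{C}\}$ (convex), and $\bar s=\operatorname{argmin}_{s\in\operatorname{cl}(\mathcal{S})}\|s\|$. The closest feasible problem is the shifted problem $\inf\{f(x):x\in X,\ C(x)\in K+\bar s\}$, whose value is $\nu(\bar s)$; it is also written as the minimization of $f(x)$ over $x\in\operatorname{argmin}_{\tilde x\in\operatorname{dom} f}\|C(\tilde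 x)-\operatorname{Proj}_K(C(\tilde x))\|$. $\operatorname{Proj}_K$ is the metric projection onto $K$. IALM. For $\gamma>0$ and $(x,s)\in\mathcal{C}$ let $L_\gamma(x,s,\lambda)=f(x)-\langle\lambda,s\rangle+\tfrac{\gamma}{2}\|s\|^2$. Given $\lambda^0\in Y$, $\gamma_k>0$, $\varepsilon_k\ge0$, for $k=0,1,2,\dots$: find $x^{k+1}\in X$, $y^{k+1}\in K$ such that, with $s^{k+1}=C(x^{k+1})-y^{k+1}$, $L_{\gamma_k}(x^{k+1},s^{k+1},\lambda^k)-\inf_{(x,s)\in\mathcal{C}}L_{\gamma_k}(x,s,\lambda^k)\le\frac{(\varepsilon_{k+1})^2}{2\gamma_k}$; set $\lambda^{k+1}=\lambda^k-\gamma_ks^{k+1}$. Error and step-size conditions: $\gamma_k>0$, $\varepsilon_k\ge 0$, and (A1) $\sum_{k=1}^\infty\varepsilon_k<\infty$; (A2) $\frac{\varepsilon_{k+1}}{\gamma_k}\sum_{i=0}^k\gamma_i=O\left(\frac{1}{\sqrt{\sum_{i=0}^k\gamma_i}}\right)$; (A3) $\sum_{k=1}^\infty\left((\varepsilon_k/\gamma_k)^2\sum_{i=0}^{k-1}\gamma_i\right)<\infty$; (A4) $\sum_{k=1}^\infty\left((\varepsilon_k/\gamma_k)\sum_{i=1}^{k}\gamma_{i-1}\right)<\infty$; (A5) $\sum_{k=0}^\infty\gamma_k=\infty$. Convergence notions. IALM simply converges to the closest feasible problem when $f(x^k)\to\nu(\bar s)$, $C(x^k)-y^k\to\bar s$,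 and $\|y^k-\operatorname{Proj}_K(C(x^k))\|\to0$. It semi-quantitatively converges if it simply converges and moreover $\|C(x^k)-y^k-\bar s\|$ and $\|y^k-\operatorname{Proj}_K(C(x^k))\|$ are both $O\left(1/\sqrt{\sum_{i=0}^{k-1}\gamma_i}\right)$.
   Formalization: Simple convergence is taken to include that the limit ν(s̄) is finite; with f(x^k) → +∞ = ν(s̄) allowed, the equivalence fails (X=[0,∞), f(x)=1/x, C(x)=x, K={0}). The second claim keeps lower semicontinuity of ν at s̄ as a hypothesis. *)

theory Defs
  imports "HOL-Analysis.Analysis" "HOL-Library.Landau_Symbols"
begin

text \<open>
  Real Hilbert spaces are types of sort \<open>{real_inner, complete_space}\<close>.
  An extended-valued function \<open>f : X \<rightarrow> \<real> \<union> {+\<infinity>}\<close> is a function into \<^typ>\<open>ereal\<close> whose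
  values are only constrained (and only used) on \<open>X\<close>.
\<close>

definition lsc_at :: "('a::topological_space \<Rightarrow> ereal) \<Rightarrow> 'a \<Rightarrow> 'a set \<Rightarrow> bool" where
  "lsc_at f x X \<longleftrightarrow> f x \<le> Liminf (at x within X) f"

definition closed_proper_convex :: "'a::real_normed_vector set \<Rightarrow> ('a \<Rightarrow> ereal) \<Rightarrow> bool" where
  "closed_proper_convex X f \<longleftrightarrow>
     (\<forall>x\<in>X. lsc_at f x X) \<and>
     (\<forall>x\<in>X. f x \<noteq> -\<infinity>) \<and> (\<exists>x\<in>X. f x \<noteq> \<infinity>) \<and>
     (\<forall>x\<in>X. \<forall>y\<in>X. \<forall>t. 0 < t \<and> t < 1 \<longrightarrow>
        f ((1 - t) *\<^sub>R x + t *\<^sub>R y) \<le> ereal (1 - t) * f x + ereal t * f y)"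

definition constraint_graph :: "'a set \<Rightarrow> 'b::real_vector set \<Rightarrow> ('a \<Rightarrow> 'b) \<Rightarrow> ('a \<times> 'b) set" where
  "constraint_graph X K C = {(x, s). x \<in> X \<and> s \<in> (\<lambda>k. C x - k) ` K}"

definition value_fun ::
  "'a set \<Rightarrow> 'b::real_vector set \<Rightarrow> ('a \<Rightarrow> ereal) \<Rightarrow> ('a \<Rightarrow> 'b) \<Rightarrow> 'b \<Rightarrow> ereal" where
  "value_fun X K f C s = (INF x\<in>{x \<in> X. C x \<in> (\<lambda>k. k + s) ` K}. f x)"

definition attainable_violations :: "'a set \<Rightarrow> 'b::real_vector set \<Rightarrow> ('a \<Rightarrow> 'b) \<Rightarrow> 'b set" where
  "attainable_violations X K C = {s. \<exists>x\<in>X. (x, s) \<in> constraint_graph X K C}"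

text \<open>
  \<open>arg_min_on\<close> is a choice of some minimizer; in the two uses below the minimizer exists and is
  unique by the Hilbert projection theorem. (The library's \<open>closest_point\<close> is restricted to
  Heine-Borel, hence finite-dimensional, spaces.)
\<close>

definition min_violation ::
  "'a set \<Rightarrow> 'b::real_inner set \<Rightarrow> ('a \<Rightarrow> 'b) \<Rightarrow> 'b" where
  "min_violation X K C = arg_min_on norm (closure (attainable_violations X K C))"

definition metric_proj :: "'b::real_inner set \<Rightarrow> 'b \<Rightarrow> 'b" where
  "metric_proj K z = arg_min_on (\<lambda>y. norm (z - y)) K"

definition aug_lagrangian ::
  "('a \<Rightarrow> ereal) \<Rightarrow> real \<Rightarrow> 'a \<Rightarrow> 'b::real_inner \<Rightarrow> 'b \<Rightarrow> ereal" where
  "aug_lagrangian f \<gamma> x s \<Lambda> = f x - ereal (\<Lambda> \<bullet> s) + ereal (\<gamma> / 2 * (norm s)\<^sup>2)"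

text \<open>
  The primal iterates and the errors are indexed from 1, so \<open>x 0\<close>, \<open>y 0\<close>, \<open>s 0\<close>, \<open>\<epsilon> 0\<close> are
  irrelevant. If the infimum below is \<open>-\<infinity>\<close>, the difference is \<open>\<infinity>\<close> and the step is impossible.
\<close>

definition ialm_sequence ::
  "'a set \<Rightarrow> 'b::real_inner set \<Rightarrow> ('a \<Rightarrow> ereal) \<Rightarrow> ('a \<Rightarrow> 'b) \<Rightarrow>
   (nat \<Rightarrow> real) \<Rightarrow> (nat \<Rightarrow> real) \<Rightarrow>
   (nat \<Rightarrow> 'a) \<Rightarrow> (nat \<Rightarrow> 'b) \<Rightarrow> (nat \<Rightarrow> 'b) \<Rightarrow> (nat \<Rightarrow> 'b) \<Rightarrow> bool" where
  "ialm_sequence X K f C \<gamma> \<epsilon> x y \<Lambda> s \<longleftrightarrow>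
     (\<forall>k. x (Suc k) \<in> X \<and> y (Suc k) \<in> K \<and>
          s (Suc k) = C (x (Suc k)) - y (Suc k) \<and>
          aug_lagrangian f (\<gamma> k) (x (Suc k)) (s (Suc k)) (\<Lambda> k)
            - (INF (x', s')\<in>constraint_graph X K C. aug_lagrangian f (\<gamma> k) x' s' (\<Lambda> k))
            \<le> ereal ((\<epsilon> (Suc k))\<^sup>2 / (2 * \<gamma> k)) \<and>
          \<Lambda> (Suc k) = \<Lambda> k - \<gamma> k *\<^sub>R s (Suc k))"

definition ialm_conditions :: "(nat \<Rightarrow> real) \<Rightarrow> (nat \<Rightarrow> real) \<Rightarrow> bool" where
  "ialm_conditions \<gamma> \<epsilon> \<longleftrightarrow>
     (\<forall>k. \<gamma> k > 0) \<and> (\<forall>k. \<epsilon> (Suc k) \<ge> 0) \<and>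
     summable (\<lambda>k. \<epsilon> (Suc k)) \<and>
     (\<lambda>k. \<epsilon> (Suc k) / \<gamma> k * (\<Sum>i\<le>k. \<gamma> i)) \<in> O(\<lambda>k. 1 / sqrt (\<Sum>i\<le>k. \<gamma> i)) \<and>
     summable (\<lambda>k. (\<epsilon> (Suc k) / \<gamma> (Suc k))\<^sup>2 * (\<Sum>i<Suc k. \<gamma> i)) \<and>
     summable (\<lambda>k. \<epsilon> (Suc k) / \<gamma> (Suc k) * (\<Sum>i=1..Suc k. \<gamma> (i - 1))) \<and>
     filterlim (\<lambda>n. \<Sum>k<n. \<gamma> k) at_top sequentially"

text \<open>
  Convergence of the objective values is convergence to a real number, hence the requirement that
  the limit be finite: if it were dropped, the equivalence with lower semicontinuity and finiteness
  at the minimal violation would fail, e.g. for \<open>X = [0,\<infinity>)\<close>, \<open>f x = 1/x\<close>, \<open>C x = x\<close>,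
  \<open>K = {0}\<close>, where \<open>f (x\<^sup>k)\<close> diverges to \<open>\<infinity>\<close>, the value of the closest feasible problem.
\<close>

definition simply_converges ::
  "'a set \<Rightarrow> 'b::real_inner set \<Rightarrow> ('a \<Rightarrow> ereal) \<Rightarrow> ('a \<Rightarrow> 'b) \<Rightarrow>
   (nat \<Rightarrow> 'a) \<Rightarrow> (nat \<Rightarrow> 'b) \<Rightarrow> bool" where
  "simply_converges X K f C x y \<longleftrightarrow>
     (let sbar = min_violation X K C; \<nu> = value_fun X K f C in
       \<bar>\<nu> sbar\<bar> \<noteq> \<infinity> \<and> (\<lambda>k. f (x k)) \<longlonglongrightarrow> \<nu> sbar \<and>
       (\<lambda>k. C (x k) - y k) \<longlonglongrightarrow> sbar \<and>
       (\<lambda>k. norm (y k - metric_proj K (C (x k)))) \<longlonglongrightarrow> 0)"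

definition semi_quantitatively_converges ::
  "'a set \<Rightarrow> 'b::real_inner set \<Rightarrow> ('a \<Rightarrow> ereal) \<Rightarrow> ('a \<Rightarrow> 'b) \<Rightarrow> (nat \<Rightarrow> real) \<Rightarrow>
   (nat \<Rightarrow> 'a) \<Rightarrow> (nat \<Rightarrow> 'b) \<Rightarrow> bool" where
  "semi_quantitatively_converges X K f C \<gamma> x y \<longleftrightarrow>
     simply_converges X K f C x y \<and>
     (\<lambda>k. norm (C (x k) - y k - min_violation X K C)) \<in> O(\<lambda>k. 1 / sqrt (\<Sum>i<k. \<gamma> i)) \<and>
     (\<lambda>k. norm (y k - metric_proj K (C (x k)))) \<in> O(\<lambda>k. 1 / sqrt (\<Sum>i<k. \<gamma> i))"

end

theory Submission
  imports Defs
begin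

text \<open>
  Each step is an inexact proximal step on the convex set \<open>M\<close> of pairs \<open>(t, r)\<close> such that \<open>r\<close>
  bounds the objective at some point with constraint violation \<open>t\<close>. Its exact solution
  \<open>(shat, rhat)\<close> lies in the closure of \<open>M\<close>, and \<open>\<mu> = \<Lambda> - \<gamma> shat\<close> is a subgradient there.
  Monotonicity of the subgradients makes \<open>|shat|\<^sup>2 - |sbar|\<^sup>2\<close> decrease up to summable errors. If
  \<open>(sbar, r)\<close> is in the closure of \<open>M\<close> for some real \<open>r\<close>, a dual objective shifted by \<open>sbar\<close>
  is bounded below, and its decrease shows that the \<open>\<gamma>\<close>-weighted sum of these quantities is
  finite. This gives the rates. The subgradient inequality at \<open>(sbar, r)\<close> then yields
  \<open>limsup f (x k) \<le> r\<close>. With \<open>r = \<nu> sbar\<close> this is half of the convergence of the objective,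
  lower semicontinuity being the other half; if \<open>\<nu>\<close> is not lower semicontinuous at \<open>sbar\<close>, some
  \<open>r < \<nu> sbar\<close> is admissible and the objective cannot converge to \<open>\<nu> sbar\<close>.
\<close>

subsection \<open>Strongly convex minimization in Hilbert spaces\<close>

text \<open>\<open>q\<close> is strongly convex in the first component and affine in the second.
  Hence the first components of a minimizing sequence are Cauchy, and convergence of the values of
  \<open>q\<close> forces the second components to converge. The limit lies only in the closure, as
  \<open>M\<close> need not be closed.\<close>

lemma strongly_convex_minimizer:
  fixes M :: "('b::{real_inner, complete_space} \<times> real) set" and a :: 'b and c :: real
  defines "q \<equiv> \<lambda>p. snd p + a \<bullet> fst p + c * (norm (fst p))\<^sup>2"
  assumes M: "convex M" "M \<noteq> {}" and c: "c > 0" and bdd: "bdd_below (q ` M)"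
  obtains p where "p \<in> closure M"
    "\<And>z. z \<in> closure M \<Longrightarrow> q p + c * (norm (fst z - fst p))\<^sup>2 \<le> q z"
proof -
  define m where "m = Inf (q ` M)"
  have m_le: "m \<le> q z" if "z \<in> M" for z
    unfolding m_def using bdd that by (intro cInf_lower) auto
  have "\<exists>z\<in>M. q z < m + inverse (real (Suc n))" for n
    using cInf_lessD[of "q ` M" "m + inverse (real (Suc n))"] M(2) by (auto simp: m_def)
  then obtain z where z: "\<And>n. z n \<in> M" and q_z: "\<And>n. q (z n) < m + inverse (real (Suc n))"
    by metis
  have q_convex: "q ((1 - t) *\<^sub>R v + t *\<^sub>R w)
      = (1 - t) * q v + t * q w - c * t * (1 - t) * (norm (fst v - fst w))\<^sup>2" for t v w
    unfolding q_def power2_norm_eq_inner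
    by (simp add: inner_simps inner_commute algebra_simps power2_eq_square)
  have m_convex: "m \<le> (1 - t) * q v + t * q w - c * t * (1 - t) * (norm (fst v - fst w))\<^sup>2"
    if "v \<in> M" "w \<in> M" "0 \<le> t" "t \<le> 1" for t v w
    using m_le[OF convexD_alt[OF M(1) that]] by (simp only: q_convex)
  have q_lim: "(\<lambda>n. q (z n)) \<longlonglongrightarrow> m"
  proof (rule tendsto_sandwich)
    show "\<forall>\<^sub>F n in sequentially. m \<le> q (z n)" "\<forall>\<^sub>F n in sequentially. q (z n) \<le> m + inverse (real (Suc n))"
      using m_le z q_z by (auto intro!: always_eventually less_imp_le)
    show "(\<lambda>n. m + inverse (real (Suc n))) \<longlonglongrightarrow> m"
      using tendsto_add[OF tendsto_const LIMSEQ_inverse_real_of_nat, of m] by simp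
  qed simp
  have "Cauchy (\<lambda>n. fst (z n))"
  proof (rule metric_CauchyI)
    fix e :: real assume "e > 0"
    \<comment> \<open>At a midpoint, strong convexity gains \<open>c / 4\<close> times the squared
      distance, so values within \<open>c * e\<^sup>2 / 4\<close> of the infimum force a distance
      below \<open>e\<close>.\<close>
    then have "0 < c * e\<^sup>2 / 4" using c by simp
    then obtain N where N: "inverse (real (Suc N)) < c * e\<^sup>2 / 4"
      using reals_Archimedean by blast
    have "dist (fst (z n)) (fst (z k)) < e" if "n \<ge> N" "k \<ge> N" for n k
    proof -
      have "q (z j) < m + c * e\<^sup>2 / 4" if "j \<ge> N" for j
      proof -
        have "inverse (real (Suc j)) \<le> inverse (real (Suc N))"
          using that by (intro le_imp_inverse_le) auto
        with q_z[of j] N show ?thesis by linarith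
      qed
      then have "q (z n) < m + c * e\<^sup>2 / 4" "q (z k) < m + c * e\<^sup>2 / 4"
        using that by blast+
      moreover have "m \<le> q (z n) / 2 + q (z k) / 2 - c / 4 * (norm (fst (z n) - fst (z k)))\<^sup>2"
        using m_convex[OF z z, of "1/2" n k] by simp
      ultimately have "c * (norm (fst (z n) - fst (z k)))\<^sup>2 < c * e\<^sup>2"
        by simp
      then show ?thesis
        using c \<open>e > 0\<close> by (simp add: dist_norm power_less_imp_less_base)
    qed
    then show "\<exists>N. \<forall>n\<ge>N. \<forall>k\<ge>N. dist (fst (z n)) (fst (z k)) < e" by blast
  qed
  then obtain u where u: "(\<lambda>n. fst (z n)) \<longlonglongrightarrow> u"
    using Cauchy_convergent convergent_def by blast
  \<comment> \<open>The second coordinate is the one that makes \<open>q p = m\<close>.\<close>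
  define p where "p = (u, m - a \<bullet> u - c * (norm u)\<^sup>2)"
  have "(\<lambda>n. (fst (z n), q (z n) - a \<bullet> fst (z n) - c * (norm (fst (z n)))\<^sup>2)) \<longlonglongrightarrow> p"
    unfolding p_def by (intro tendsto_intros u q_lim)
  then have "z \<longlonglongrightarrow> p"
    by (simp add: q_def)
  then have p: "p \<in> closure M"
    using z unfolding closure_sequential by blast
  have q_p: "q p = m" by (simp add: q_def p_def)
  have on_M: "q p + c * (norm (fst w - fst p))\<^sup>2 \<le> q w" if w: "w \<in> M" for w
  proof -
    \<comment> \<open>Compare with the points of the segment from \<open>z n\<close> to
      \<open>w\<close>: in the limit over \<open>n\<close> a factor \<open>t\<close> cancels, and
      letting \<open>t\<close> tend to 0 leaves the full constant \<open>c\<close>.\<close>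
    have "m + c * (1 - t) * (norm (u - fst w))\<^sup>2 \<le> q w" if t: "0 < t" "t < 1" for t
    proof -
      have "(\<lambda>n. (1 - t) * q (z n) + t * q w - c * t * (1 - t) * (norm (fst (z n) - fst w))\<^sup>2)
          \<longlonglongrightarrow> (1 - t) * m + t * q w - c * t * (1 - t) * (norm (u - fst w))\<^sup>2"
        by (intro tendsto_intros u q_lim)
      then have "m \<le> (1 - t) * m + t * q w - c * t * (1 - t) * (norm (u - fst w))\<^sup>2"
        using m_convex[OF z w] t by (intro LIMSEQ_le_const) auto
      then have "t * (m + c * (1 - t) * (norm (u - fst w))\<^sup>2) \<le> t * q w"
        by (simp add: algebra_simps)
      with t show ?thesis by simp
    qed
    then have "\<forall>\<^sub>F t in at_right 0. m + c * (1 - t) * (norm (u - fst w))\<^sup>2 \<le> q w"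
      by (auto simp: eventually_at_right[of 0 1] intro!: exI[of _ 1])
    moreover have "((\<lambda>t. m + c * (1 - t) * (norm (u - fst w))\<^sup>2)
        \<longlongrightarrow> m + c * (1 - 0) * (norm (u - fst w))\<^sup>2) (at_right 0)"
      by (intro tendsto_intros)
    ultimately have "m + c * (1 - 0) * (norm (u - fst w))\<^sup>2 \<le> q w"
      by (intro tendsto_upperbound) auto
    then show ?thesis
      using q_p by (simp add: p_def norm_minus_commute)
  qed
  have "closed {w. q p + c * (norm (fst w - fst p))\<^sup>2 \<le> q w}"
    unfolding q_def by (intro closed_Collect_le continuous_intros)
  then have "closure M \<subseteq> {w. q p + c * (norm (fst w - fst p))\<^sup>2 \<le> q w}"
    using on_M by (intro closure_minimal) auto
  with p show thesis by (intro that) auto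
qed

text \<open>Hilbert projection theorem: on \<open>S \<times> {0}\<close> the function
  \<open>q\<close> of the previous lemma is the squared distance to \<open>z\<close> up to a
  constant. Existence of one minimizer makes the Hilbert choice in \<open>arg_min_on\<close> a
  minimizer too.\<close>

lemma arg_min_on_dist:
  fixes S :: "'b::{real_inner, complete_space} set" and z :: 'b
  assumes "S \<noteq> {}" "closed S" "convex S"
  defines "p \<equiv> arg_min_on (\<lambda>y. norm (z - y)) S"
  shows "p \<in> S" "\<And>y. y \<in> S \<Longrightarrow> norm (z - p) \<le> norm (z - y)"
proof -
  let ?M = "S \<times> {0 :: real}"
  let ?q = "\<lambda>u :: 'b \<times> real. snd u + (- 2 *\<^sub>R z) \<bullet> fst u + 1 * (norm (fst u))\<^sup>2"
  have q: "?q (y, 0) = (norm (z - y))\<^sup>2 - (norm z)\<^sup>2" for y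
    unfolding power2_norm_eq_inner by (simp add: inner_simps inner_commute)
  have "bdd_below (?q ` ?M)"
  proof (rule bdd_belowI2)
    fix u assume "u \<in> ?M"
    then have "?q u = (norm (z - fst u))\<^sup>2 - (norm z)\<^sup>2"
      using q[of "fst u"] by auto
    then show "- (norm z)\<^sup>2 \<le> ?q u" by simp
  qed
  then obtain u where u: "u \<in> closure ?M"
    and min: "\<And>w. w \<in> closure ?M \<Longrightarrow> ?q u + 1 * (norm (fst w - fst u))\<^sup>2 \<le> ?q w"
    using strongly_convex_minimizer[of ?M 1 "- 2 *\<^sub>R z"] assms by (auto simp: convex_Times)
  have closure: "closure ?M = S \<times> {0}"
    using assms by (simp add: closure_Times)
  obtain a where a: "u = (a, 0)" "a \<in> S"
    using u unfolding closure by blast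
  have "norm (z - a) \<le> norm (z - y)" if "y \<in> S" for y
  proof -
    have "(y, 0) \<in> closure ?M"
      unfolding closure using that by blast
    from min[OF this] have "(norm (z - a))\<^sup>2 + (norm (y - a))\<^sup>2 \<le> (norm (z - y))\<^sup>2"
      unfolding a q by simp
    then have "(norm (z - a))\<^sup>2 \<le> (norm (z - y))\<^sup>2"
      using zero_le_power2[of "norm (y - a)"] by linarith
    then show ?thesis by (rule power2_le_imp_le) simp
  qed
  then have "is_arg_min (\<lambda>y. norm (z - y)) (\<lambda>y. y \<in> S) a"
    using a(2) unfolding is_arg_min_linorder by blast
  then have "is_arg_min (\<lambda>y. norm (z - y)) (\<lambda>y. y \<in> S) p"
    unfolding p_def arg_min_on_def arg_min_def by (rule someI)
  then show "p \<in> S" "\<And>y. y \<in> S \<Longrightarrow> norm (z - p) \<le> norm (z - y)"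
    unfolding is_arg_min_linorder by blast+
qed

subsection \<open>Growth of sequences\<close>

lemma bounded_by_summable_increments:
  fixes a b :: "nat \<Rightarrow> real"
  assumes "\<And>k. a (Suc k) \<le> a k + b k" "\<And>k. b k \<ge> 0" "summable b"
  shows "a k \<le> a 0 + suminf b"
proof -
  have "a k \<le> a 0 + (\<Sum>i<k. b i)"
  proof (induction k)
    case (Suc k)
    then show ?case using assms(1)[of k] by simp
  qed simp
  then show ?thesis
    using sum_le_suminf[OF assms(3), of "{..<k}"] assms(2) by force
qed

lemma bigo_sqrt:
  fixes g h :: "nat \<Rightarrow> real"
  assumes "(\<lambda>k. (g k)\<^sup>2) \<in> O(h)" "\<And>k. h k \<ge> 0"
  shows "g \<in> O(\<lambda>k. sqrt (h k))"
proof -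
  obtain c where c: "c > 0" "\<forall>\<^sub>F k in sequentially. norm ((g k)\<^sup>2) \<le> c * norm (h k)"
    using landau_o.bigE[OF assms(1)] by blast
  from c(2) have "\<forall>\<^sub>F k in sequentially. norm (g k) \<le> sqrt c * norm (sqrt (h k))"
  proof eventually_elim
    case (elim k)
    then have "sqrt ((g k)\<^sup>2) \<le> sqrt (c * h k)"
      using assms(2) by (intro real_sqrt_le_mono) simp
    then show ?case using assms(2) by (simp add: real_sqrt_mult)
  qed
  then show ?thesis by (rule bigoI)
qed

lemma bigo_tendsto_zero:
  fixes g h :: "nat \<Rightarrow> real"
  assumes "g \<in> O(h)" "h \<longlonglongrightarrow> 0"
  shows "g \<longlonglongrightarrow> 0"
proof -
  have "h \<in> o(\<lambda>_. 1)"
    using assms(2) by (intro smalloI_tendsto) auto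
  then have "g \<in> o(\<lambda>_. 1)"
    using assms(1) landau_o.big_small_trans by blast
  then show ?thesis
    using smalloD_tendsto by fastforce
qed

lemma bigo_Suc_imp_bigo:
  fixes g h :: "nat \<Rightarrow> real"
  assumes "(\<lambda>k. g (Suc k)) \<in> O(\<lambda>k. h (Suc k))"
  shows "g \<in> O(h)"
proof -
  obtain c where "\<forall>\<^sub>F k in sequentially. norm (g (Suc k)) \<le> c * norm (h (Suc k))"
    using landau_o.bigE[OF assms] by blast
  then have "\<forall>\<^sub>F k in sequentially. norm (g k) \<le> c * norm (h k)"
    by (subst (asm) eventually_sequentially_Suc)
  then show ?thesis by (rule bigoI)
qed

text \<open>After dropping \<open>N\<close> terms, the remaining weighted squares sum to less than
  \<open>(e/2)\<^sup>2\<close>. Cauchy-Schwarz with weights \<open>sqrt (\<gamma> i)\<close> bounds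
  the tail by \<open>e/2\<close> times the root of the step sum, and divergence of the step sum
  absorbs the fixed head \<open>B\<close>.\<close>

lemma weighted_sum_smallo_sqrt:
  fixes \<gamma> b :: "nat \<Rightarrow> real"
  assumes \<gamma>: "\<And>i. \<gamma> i > 0" and b: "\<And>i. b i \<ge> 0"
    and sumb: "summable (\<lambda>i. \<gamma> i * (b i)\<^sup>2)"
    and lim: "filterlim (\<lambda>k. \<Sum>i\<le>k. \<gamma> i) at_top sequentially"
  shows "(\<lambda>k. \<Sum>i\<le>k. \<gamma> i * b i) \<in> o(\<lambda>k. sqrt (\<Sum>i\<le>k. \<gamma> i))"
proof (rule landau_o.smallI)
  fix e :: real assume e: "e > 0"
  define G where "G = (\<lambda>k. \<Sum>i\<le>k. \<gamma> i)"
  obtain N where N: "\<And>n. norm (\<Sum>i=N..<n. \<gamma> i * (b i)\<^sup>2) < (e/2)\<^sup>2"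
    using sumb[unfolded summable_Cauchy] e by (metis half_gt_zero order_refl zero_less_power)
  define B where "B = (\<Sum>i<N. \<gamma> i * b i)"
  have "filterlim (\<lambda>k. sqrt (G k)) at_top sequentially"
    unfolding G_def by (rule filterlim_compose[OF sqrt_at_top lim])
  then have "\<forall>\<^sub>F k in sequentially. 2 * B / e \<le> sqrt (G k)"
    by (simp add: filterlim_at_top)
  then show "\<forall>\<^sub>F k in sequentially. norm (\<Sum>i\<le>k. \<gamma> i * b i) \<le> e * norm (sqrt (\<Sum>i\<le>k. \<gamma> i))"
    using eventually_ge_at_top[of N]
  proof eventually_elim
    case (elim k)
    have G0: "G k \<ge> 0" unfolding G_def using \<gamma> by (intro sum_nonneg) (auto intro: less_imp_le)
    have "(\<Sum>i=N..<Suc k. \<gamma> i * b i)\<^sup>2 = (\<Sum>i=N..<Suc k. sqrt (\<gamma> i) * (sqrt (\<gamma> i) * b i))\<^sup>2"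
      using \<gamma> by (simp add: less_imp_le flip: mult.assoc)
    also have "\<dots> \<le> (\<Sum>i=N..<Suc k. (sqrt (\<gamma> i))\<^sup>2) * (\<Sum>i=N..<Suc k. (sqrt (\<gamma> i) * b i)\<^sup>2)"
      by (rule Cauchy_Schwarz_ineq_sum)
    also have "\<dots> = (\<Sum>i=N..<Suc k. \<gamma> i) * (\<Sum>i=N..<Suc k. \<gamma> i * (b i)\<^sup>2)"
      using \<gamma> by (simp add: less_imp_le power_mult_distrib)
    also have "\<dots> \<le> G k * (e/2)\<^sup>2"
    proof (rule mult_mono)
      show "(\<Sum>i=N..<Suc k. \<gamma> i) \<le> G k"
        unfolding G_def using \<gamma> by (intro sum_mono2) (auto intro: less_imp_le)
      show "(\<Sum>i=N..<Suc k. \<gamma> i * (b i)\<^sup>2) \<le> (e/2)\<^sup>2"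
        using N[of "Suc k"] by (simp del: sum.op_ivl_Suc)
      show "0 \<le> (\<Sum>i=N..<Suc k. \<gamma> i * (b i)\<^sup>2)"
        using \<gamma> by (intro sum_nonneg mult_nonneg_nonneg) (auto intro: less_imp_le)
    qed (use G0 in auto)
    also have "\<dots> = (sqrt (G k) * (e/2))\<^sup>2"
      using G0 by (simp add: power_mult_distrib power_divide)
    finally have tail: "(\<Sum>i=N..<Suc k. \<gamma> i * b i) \<le> sqrt (G k) * (e/2)"
      by (rule power2_le_imp_le) (use e G0 in simp)
    have "{..k} = {..<N} \<union> {N..<Suc k}" using elim by auto
    then have "(\<Sum>i\<le>k. \<gamma> i * b i) = B + (\<Sum>i=N..<Suc k. \<gamma> i * b i)"
      unfolding B_def by (simp add: sum.union_disjoint ivl_disj_int del: sum.op_ivl_Suc)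
    also have "\<dots> \<le> e * sqrt (G k)"
      using tail elim(1) e by (simp add: field_simps)
    finally show ?case
      using sum_nonneg[of "{..k}" "\<lambda>i. \<gamma> i * b i"] \<gamma> b G0
      by (simp add: G_def less_imp_le)
  qed
qed

subsection \<open>Inexact proximal steps on a convex epigraph\<close>

text \<open>\<open>obtuse_M\<close> and \<open>sbar_closure\<close> make \<open>sbar\<close> the
  minimal norm point of the closure of the first projection of \<open>M\<close>. Asking for
  \<open>(sbar, rbar)\<close> only in the closure allows \<open>rbar\<close> below the value at
  \<open>sbar\<close> when lower semicontinuity fails.\<close>

locale inexact_proximal =
  fixes M :: "('b::{real_inner, complete_space} \<times> real) set"
    and sbar :: 'b and rbar :: real and \<gamma> \<epsilon> v :: "nat \<Rightarrow> real" and s \<Lambda> :: "nat \<Rightarrow> 'b"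
  assumes convex_M: "convex M"
    and step_pos: "\<gamma> k > 0"
    and error_nonneg: "\<epsilon> k \<ge> 0"
    and iterate_mem: "(s k, v k) \<in> M"
    and iterate_le: "(t, r) \<in> M \<Longrightarrow> v k - \<Lambda> k \<bullet> s k + \<gamma> k / 2 * (norm (s k))\<^sup>2
        \<le> r - \<Lambda> k \<bullet> t + \<gamma> k / 2 * (norm t)\<^sup>2 + (\<epsilon> k)\<^sup>2 / (2 * \<gamma> k)"
    and multiplier_Suc: "\<Lambda> (Suc k) = \<Lambda> k - \<gamma> k *\<^sub>R s k"
    and obtuse_M: "(t, r) \<in> M \<Longrightarrow> 0 \<le> sbar \<bullet> (t - sbar)"
    and sbar_closure: "(sbar, rbar) \<in> closure M"
    and error_summable: "summable \<epsilon>"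
    and error_bigo: "(\<lambda>k. \<epsilon> k / \<gamma> k * (\<Sum>i\<le>k. \<gamma> i)) \<in> O(\<lambda>k. 1 / sqrt (\<Sum>i\<le>k. \<gamma> i))"
    and error_square_summable: "summable (\<lambda>k. (\<epsilon> k / \<gamma> (Suc k))\<^sup>2 * (\<Sum>i\<le>k. \<gamma> i))"
    and step_sum: "filterlim (\<lambda>k. \<Sum>i\<le>k. \<gamma> i) at_top sequentially"
begin

definition \<Gamma> :: "nat \<Rightarrow> real" where "\<Gamma> k = (\<Sum>i\<le>k. \<gamma> i)"

text \<open>
  \<open>p\<close> is the exact proximal point and its value; it need only lie in the closure of \<open>M\<close>,
  since the value function is not assumed to be closed.
\<close>

definition "exact_step k p \<longleftrightarrow> p \<in> closure M \<and>
  norm (s k - fst p) \<le> \<epsilon> k / \<gamma> k \<and>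
  (\<forall>z\<in>closure M. snd p + (\<Lambda> k - \<gamma> k *\<^sub>R fst p) \<bullet> (fst z - fst p) \<le> snd z) \<and>
  v k \<le> snd p + (\<Lambda> k - \<gamma> k *\<^sub>R fst p) \<bullet> (s k - fst p) + (\<epsilon> k)\<^sup>2 / (2 * \<gamma> k)"

text \<open>Quadratic growth around the exact minimizer \<open>p\<close>, applied to the iterate,
  bounds \<open>\<gamma> k / 2\<close> times their squared distance by
  \<open>(\<epsilon> k)\<^sup>2 / (2 * \<gamma> k)\<close>; this scaling of the error yields the
  distance \<open>\<epsilon> k / \<gamma> k\<close>.\<close>

lemma exact_step_exists: "\<exists>p. exact_step k p"
proof -
  define q where "q = (\<lambda>p. snd p + (- \<Lambda> k) \<bullet> fst p + \<gamma> k / 2 * (norm (fst p))\<^sup>2)"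
  define \<eta> where "\<eta> = (\<epsilon> k)\<^sup>2 / (2 * \<gamma> k)"
  have approx_M: "q (s k, v k) \<le> q z + \<eta>" if "z \<in> M" for z
    using iterate_le[of "fst z" "snd z" k] that by (simp add: q_def \<eta>_def)
  have "closed {z. q (s k, v k) \<le> q z + \<eta>}"
    unfolding q_def by (intro closed_Collect_le continuous_intros)
  then have "closure M \<subseteq> {z. q (s k, v k) \<le> q z + \<eta>}"
    using approx_M by (intro closure_minimal) auto
  then have approx: "q (s k, v k) \<le> q z + \<eta>" if "z \<in> closure M" for z
    using that by blast
  have "bdd_below (q ` M)"
    using approx_M by (intro bdd_belowI[of _ "q (s k, v k) - \<eta>"]) (auto simp: diff_le_eq)
  moreover have "M \<noteq> {}" "\<gamma> k / 2 > 0"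
    using iterate_mem step_pos by auto
  ultimately obtain p where p: "p \<in> closure M"
    and p_min: "\<And>z. z \<in> closure M \<Longrightarrow> q p + \<gamma> k / 2 * (norm (fst z - fst p))\<^sup>2 \<le> q z"
    using strongly_convex_minimizer[OF convex_M, of "\<gamma> k / 2" "- \<Lambda> k"]
    unfolding q_def by blast
  have iterate_closure: "(s k, v k) \<in> closure M"
    using iterate_mem closure_subset by blast
  have "\<gamma> k / 2 * (norm (s k - fst p))\<^sup>2 \<le> \<eta>"
    using p_min[OF iterate_closure] approx[OF p] by simp
  then have "(norm (s k - fst p))\<^sup>2 \<le> (\<epsilon> k / \<gamma> k)\<^sup>2"
    using step_pos[of k] by (simp add: \<eta>_def field_simps power2_eq_square)
  then have dist: "norm (s k - fst p) \<le> \<epsilon> k / \<gamma> k"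
    using step_pos[of k] error_nonneg[of k] by (auto intro: power2_le_imp_le)
  \<comment> \<open>Taylor expansion of \<open>q\<close> at \<open>p\<close>. Its quadratic
    remainder is exactly the growth term in \<open>p_min\<close>, so cancelling both leaves the
    subgradient inequality.\<close>
  have expand: "q z = q p + snd z - snd p - (\<Lambda> k - \<gamma> k *\<^sub>R fst p) \<bullet> (fst z - fst p)
      + \<gamma> k / 2 * (norm (fst z - fst p))\<^sup>2" for z
    unfolding q_def power2_norm_eq_inner
    by (simp add: inner_simps inner_commute algebra_simps)
  have "snd p + (\<Lambda> k - \<gamma> k *\<^sub>R fst p) \<bullet> (fst z - fst p) \<le> snd z" if "z \<in> closure M" for z
    using p_min[OF that] expand[of z] by linarith
  moreover have "v k \<le> snd p + (\<Lambda> k - \<gamma> k *\<^sub>R fst p) \<bullet> (s k - fst p) + \<eta>"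
  proof -
    have "0 \<le> \<gamma> k / 2 * (norm (s k - fst p))\<^sup>2"
      using step_pos[of k] by simp
    with approx[OF p] expand[of "(s k, v k)", unfolded fst_conv snd_conv] show ?thesis
      by linarith
  qed
  ultimately show ?thesis
    using p dist unfolding exact_step_def \<eta>_def by blast
qed

definition shat :: "nat \<Rightarrow> 'b" where "shat k = fst (SOME p. exact_step k p)"
definition rhat :: "nat \<Rightarrow> real" where "rhat k = snd (SOME p. exact_step k p)"
definition \<mu> :: "nat \<Rightarrow> 'b" where "\<mu> k = \<Lambda> k - \<gamma> k *\<^sub>R shat k"

lemma exact_step: "exact_step k (shat k, rhat k)"
  unfolding shat_def rhat_def using someI_ex[OF exact_step_exists] by simp

lemma
  shows exact_mem: "(shat k, rhat k) \<in> closure M"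
    and exact_dist: "norm (s k - shat k) \<le> \<epsilon> k / \<gamma> k"
    and subgradient: "(t, r) \<in> closure M \<Longrightarrow> rhat k + \<mu> k \<bullet> (t - shat k) \<le> r"
    and value_le: "v k \<le> rhat k + \<mu> k \<bullet> (s k - shat k) + (\<epsilon> k)\<^sup>2 / (2 * \<gamma> k)"
  using exact_step[of k] unfolding exact_step_def \<mu>_def by auto

lemma obtuse:
  assumes "(t, r) \<in> closure M"
  shows "0 \<le> sbar \<bullet> (t - sbar)"
proof -
  have "closed {z :: 'b \<times> real. 0 \<le> sbar \<bullet> (fst z - sbar)}"
    by (intro closed_Collect_le continuous_intros)
  then have "closure M \<subseteq> {z. 0 \<le> sbar \<bullet> (fst z - sbar)}"
    using obtuse_M by (intro closure_minimal) auto
  with assms show ?thesis by auto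
qed

text \<open>The factor \<open>\<gamma> k\<close> of the update cancels the denominator in
  \<open>exact_dist\<close>, so the multiplier errors are summable whatever the step sizes
  are.\<close>

lemma multiplier_dist: "norm (\<mu> k - \<Lambda> (Suc k)) \<le> \<epsilon> k"
proof -
  have "\<mu> k - \<Lambda> (Suc k) = \<gamma> k *\<^sub>R (s k - shat k)"
    by (simp add: \<mu>_def multiplier_Suc algebra_simps)
  then have "norm (\<mu> k - \<Lambda> (Suc k)) = \<gamma> k * norm (s k - shat k)"
    using step_pos[of k] by (simp only: norm_scaleR abs_of_pos)
  then show ?thesis
    using exact_dist[of k] step_pos[of k] by (simp add: pos_le_divide_eq mult.commute)
qed

lemma \<Gamma>_pos: "\<Gamma> k > 0"
  unfolding \<Gamma>_def using step_pos by (intro sum_pos) auto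

lemma \<Gamma>_ge: "\<gamma> 0 \<le> \<Gamma> k"
  unfolding \<Gamma>_def using step_pos by (intro member_le_sum) (auto intro: less_imp_le)

section \<open>Almost monotone decrease of the excess squared norm\<close>

definition gap :: "nat \<Rightarrow> real" where "gap k = (norm (shat k))\<^sup>2 - (norm sbar)\<^sup>2"

text \<open>The two sides differ by \<open>2 * (sbar \<bullet> (t - sbar))\<close>. Excess squared
  norms, which the monotonicity argument below handles, thus control distances to
  \<open>sbar\<close>.\<close>

lemma norm_diff_sbar_le:
  assumes "(t, r) \<in> closure M"
  shows "(norm (t - sbar))\<^sup>2 \<le> (norm t)\<^sup>2 - (norm sbar)\<^sup>2"
  using obtuse[OF assms] unfolding power2_norm_eq_inner
  by (simp add: inner_simps inner_commute algebra_simps)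

lemma gap_ge: "(norm (shat k - sbar))\<^sup>2 \<le> gap k"
  unfolding gap_def by (rule norm_diff_sbar_le[OF exact_mem])

lemma gap_nonneg: "0 \<le> gap k"
  using gap_ge[of k] by (meson order_trans zero_le_power2)

text \<open>Monotonicity of the subgradients at consecutive exact points bounds
  \<open>shat (Suc k) \<bullet> ?d\<close> by \<open>\<delta> * D\<close>. The
  \<open>D\<^sup>2\<close> from expanding the norms absorbs the one produced by Young's
  inequality.\<close>

lemma gap_Suc_le: "gap (Suc k) \<le> gap k + (\<epsilon> k / \<gamma> (Suc k))\<^sup>2"
proof -
  let ?d = "shat (Suc k) - shat k" and ?g = "\<gamma> (Suc k)"
  define D where "D = norm ?d"
  define \<delta> where "\<delta> = \<epsilon> k / ?g"
  note g = step_pos[of "Suc k"]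
  have "0 \<le> (\<mu> (Suc k) - \<mu> k) \<bullet> ?d"
    using subgradient[OF exact_mem, of k "Suc k"] subgradient[OF exact_mem, of "Suc k" k]
    by (simp add: inner_simps)
  moreover have "\<mu> (Suc k) - \<mu> k = - ?g *\<^sub>R shat (Suc k) - (\<mu> k - \<Lambda> (Suc k))"
    by (simp add: \<mu>_def)
  ultimately have "?g * (shat (Suc k) \<bullet> ?d) \<le> - ((\<mu> k - \<Lambda> (Suc k)) \<bullet> ?d)"
    by (simp add: inner_diff_left)
  also have "\<dots> \<le> norm (\<mu> k - \<Lambda> (Suc k)) * D"
    unfolding D_def using Cauchy_Schwarz_ineq2[of "\<mu> k - \<Lambda> (Suc k)" ?d] by linarith
  also have "\<dots> \<le> \<epsilon> k * D"
    using multiplier_dist by (intro mult_right_mono) (auto simp: D_def)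
  finally have "shat (Suc k) \<bullet> ?d \<le> \<delta> * D"
    using g by (simp add: \<delta>_def field_simps)
  moreover have "(norm (shat (Suc k)))\<^sup>2 - (norm (shat k))\<^sup>2 + D\<^sup>2 = 2 * (shat (Suc k) \<bullet> ?d)"
    unfolding D_def power2_norm_eq_inner by (simp add: inner_simps inner_commute)
  moreover have "2 * (\<delta> * D) \<le> \<delta>\<^sup>2 + D\<^sup>2"
    using sum_squares_bound[of \<delta> D] by simp
  ultimately show ?thesis
    unfolding gap_def \<delta>_def[symmetric] by linarith
qed

lemma error_ratio_summable: "summable (\<lambda>k. (\<epsilon> k / \<gamma> (Suc k))\<^sup>2)"
proof (rule summable_comparison_test)
  show "summable (\<lambda>k. (1 / \<gamma> 0) * ((\<epsilon> k / \<gamma> (Suc k))\<^sup>2 * \<Gamma> k))"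
    using error_square_summable unfolding \<Gamma>_def by (rule summable_mult)
  have "(\<epsilon> k / \<gamma> (Suc k))\<^sup>2 * 1 \<le> (\<epsilon> k / \<gamma> (Suc k))\<^sup>2 * (\<Gamma> k / \<gamma> 0)" for k
    using \<Gamma>_ge[of k] step_pos[of 0] by (intro mult_left_mono) auto
  then show "\<exists>N. \<forall>n\<ge>N. norm ((\<epsilon> n / \<gamma> (Suc n))\<^sup>2)
      \<le> (1 / \<gamma> 0) * ((\<epsilon> n / \<gamma> (Suc n))\<^sup>2 * \<Gamma> n)"
    by (simp add: mult.commute mult.left_commute)
qed

lemma shat_bounded: obtains R where "R \<ge> 0" "\<And>k. norm (shat k - sbar) \<le> R"
proof
  let ?B = "gap 0 + (\<Sum>k. (\<epsilon> k / \<gamma> (Suc k))\<^sup>2)"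
  have B: "gap k \<le> ?B" for k
    by (rule bounded_by_summable_increments[OF gap_Suc_le _ error_ratio_summable]) simp
  show "0 \<le> sqrt ?B"
    using B[of 0] gap_nonneg[of 0] by simp
  show "norm (shat k - sbar) \<le> sqrt ?B" for k
    using gap_ge[of k] B[of k] by (intro real_le_rsqrt) linarith
qed

section \<open>Summability of the weighted gaps from a dual objective\<close>

text \<open>
  If \<open>D\<close> is the conjugate of the function with epigraph \<open>M\<close>, then \<open>E k = D (\<mu> k) - \<mu> k \<bullet> sbar\<close>:
  a dual objective that stays bounded below even when the multipliers diverge along \<open>- sbar\<close>.
\<close>

definition E :: "nat \<Rightarrow> real" where "E k = \<mu> k \<bullet> (shat k - sbar) - rhat k"

lemma E_ge: "- rbar \<le> E k"
  using subgradient[OF sbar_closure, of k] by (simp add: E_def inner_diff_right)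

text \<open>Test the subgradient inequality of step \<open>k\<close> at the next exact point. The
  exact multipliers differ by \<open>\<gamma> (Suc k) *\<^sub>R shat (Suc k)\<close> up to an error
  of norm at most \<open>\<epsilon> k\<close>, and
  \<open>shat (Suc k) \<bullet> (shat (Suc k) - sbar)\<close> is at least half of
  \<open>gap (Suc k)\<close>.\<close>

lemma E_decrease:
  "\<gamma> (Suc k) / 2 * gap (Suc k) \<le> E k - E (Suc k) + \<epsilon> k * norm (shat (Suc k) - sbar)"
proof -
  let ?u = "shat (Suc k) - sbar" and ?g = "\<gamma> (Suc k)"
  have "(\<mu> k - \<mu> (Suc k)) \<bullet> ?u \<le> E k - E (Suc k)"
    using subgradient[OF exact_mem, of k "Suc k"] by (simp add: E_def inner_simps)
  moreover have "\<mu> k - \<mu> (Suc k) = ?g *\<^sub>R shat (Suc k) + (\<mu> k - \<Lambda> (Suc k))"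
    by (simp add: \<mu>_def)
  ultimately have "?g * (shat (Suc k) \<bullet> ?u) + (\<mu> k - \<Lambda> (Suc k)) \<bullet> ?u \<le> E k - E (Suc k)"
    by (simp add: inner_add_left)
  moreover have "- ((\<mu> k - \<Lambda> (Suc k)) \<bullet> ?u) \<le> \<epsilon> k * norm ?u"
    using Cauchy_Schwarz_ineq2[of "\<mu> k - \<Lambda> (Suc k)" ?u]
      mult_right_mono[OF multiplier_dist[of k] norm_ge_zero[of ?u]] by linarith
  moreover have "gap (Suc k) \<le> 2 * (shat (Suc k) \<bullet> ?u)"
  proof -
    have "2 * (shat (Suc k) \<bullet> ?u) - gap (Suc k) = (norm ?u)\<^sup>2"
      unfolding gap_def power2_norm_eq_inner by (simp add: inner_simps inner_commute)
    then show ?thesis by (metis diff_ge_0_iff_ge zero_le_power2)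
  qed
  then have "?g / 2 * gap (Suc k) \<le> ?g * (shat (Suc k) \<bullet> ?u)"
    using mult_left_mono[of "gap (Suc k)" "2 * (shat (Suc k) \<bullet> ?u)" "?g / 2"] step_pos[of "Suc k"]
    by simp
  ultimately show ?thesis by linarith
qed

text \<open>The decrease of \<open>E\<close> telescopes and \<open>E\<close> is bounded below by
  \<open>- rbar\<close>; the errors \<open>\<epsilon> k * R\<close> are summable because the exact
  points are bounded.\<close>

lemma weighted_gap_summable: "summable (\<lambda>k. \<gamma> k * gap k)"
proof -
  obtain R where R: "R \<ge> 0" "\<And>k. norm (shat k - sbar) \<le> R"
    using shat_bounded by blast
  have "(\<Sum>k<n. norm (\<gamma> (Suc k) * gap (Suc k))) \<le> 2 * (E 0 + rbar + suminf \<epsilon> * R)" for n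
  proof -
    have step: "\<gamma> (Suc k) * gap (Suc k) \<le> 2 * (E k - E (Suc k) + \<epsilon> k * R)" for k
      using E_decrease[of k] mult_left_mono[OF R(2) error_nonneg, of k "Suc k"] by simp
    have "(\<Sum>k<n. norm (\<gamma> (Suc k) * gap (Suc k))) = (\<Sum>k<n. \<gamma> (Suc k) * gap (Suc k))"
      using gap_nonneg step_pos by (intro sum.cong) (auto simp: less_imp_le)
    also have "\<dots> \<le> (\<Sum>k<n. 2 * (E k - E (Suc k) + \<epsilon> k * R))"
      by (intro sum_mono step)
    also have "\<dots> = 2 * ((E 0 - E n) + (\<Sum>k<n. \<epsilon> k) * R)"
      by (simp only: sum.distrib sum_lessThan_telescope' sum_distrib_left[symmetric] sum_distrib_right[symmetric])
    also have "\<dots> \<le> 2 * (E 0 + rbar + suminf \<epsilon> * R)"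
      using E_ge[of n] mult_right_mono[OF sum_le_suminf[OF error_summable, of "{..<n}"] R(1)]
        error_nonneg by simp
    finally show ?thesis .
  qed
  then have "summable (\<lambda>k. norm (\<gamma> (Suc k) * gap (Suc k)))"
    by (intro summableI_nonneg_bounded) auto
  then show ?thesis
    using summable_norm_cancel summable_Suc_iff by blast
qed

section \<open>Convergence rates of the gap and of the iterates\<close>

lemma gap_bigo: "gap \<in> O(\<lambda>k. 1 / \<Gamma> k)"
proof -
  let ?b = "\<lambda>k. (\<epsilon> k / \<gamma> (Suc k))\<^sup>2 * \<Gamma> k + \<gamma> (Suc k) * gap (Suc k)"
  \<comment> \<open>Split \<open>\<Gamma> (Suc k)\<close> as
    \<open>\<Gamma> k + \<gamma> (Suc k)\<close>: \<open>gap_Suc_le\<close> handles the first part,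
    and the second is a term of the summable weighted sum.\<close>
  have "\<Gamma> (Suc k) * gap (Suc k) \<le> \<Gamma> k * gap k + ?b k" for k
    using mult_left_mono[OF gap_Suc_le less_imp_le[OF \<Gamma>_pos], of k k]
    by (simp add: \<Gamma>_def algebra_simps)
  moreover have "?b k \<ge> 0" for k
    using gap_nonneg \<Gamma>_pos step_pos by (simp add: less_imp_le)
  moreover have "summable ?b"
    using error_square_summable weighted_gap_summable
      summable_Suc_iff[of "\<lambda>k. \<gamma> k * gap k"]
    by (intro summable_add) (simp_all add: \<Gamma>_def)
  ultimately have *: "\<Gamma> k * gap k \<le> \<Gamma> 0 * gap 0 + suminf ?b" for k
    by (rule bounded_by_summable_increments)
  show ?thesis
  proof (rule bigoI[where c = "\<Gamma> 0 * gap 0 + suminf ?b"], rule always_eventually, rule allI)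
    fix k
    show "norm (gap k) \<le> (\<Gamma> 0 * gap 0 + suminf ?b) * norm (1 / \<Gamma> k)"
      using *[of k] gap_nonneg[of k] \<Gamma>_pos[of k] by (simp add: pos_le_divide_eq mult.commute)
  qed
qed

lemma \<Gamma>_at_top: "filterlim \<Gamma> at_top sequentially"
  using step_sum by (simp add: \<Gamma>_def[abs_def])

lemma inverse_\<Gamma>_tendsto: "(\<lambda>k. 1 / \<Gamma> k) \<longlonglongrightarrow> 0"
  using tendsto_divide_0[OF tendsto_const filterlim_at_top_imp_at_infinity[OF \<Gamma>_at_top]] .

lemma exact_dist_bigo: "(\<lambda>k. \<epsilon> k / \<gamma> k) \<in> O(\<lambda>k. 1 / \<Gamma> k)"
proof -
  have "(\<lambda>k. \<epsilon> k / \<gamma> k * \<Gamma> k) \<in> O(\<lambda>k. 1 / sqrt (\<Gamma> k))"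
    using error_bigo by (simp add: \<Gamma>_def)
  also have "(\<lambda>k. 1 / sqrt (\<Gamma> k)) \<in> O(\<lambda>_. 1)"
  proof (rule bigoI[where c = "1 / sqrt (\<gamma> 0)"], rule always_eventually, rule allI)
    show "norm (1 / sqrt (\<Gamma> k)) \<le> 1 / sqrt (\<gamma> 0) * norm (1 :: real)" for k
      using \<Gamma>_ge[of k] step_pos[of 0] by (simp add: frac_le)
  qed
  finally have "(\<lambda>k. \<epsilon> k / \<gamma> k * \<Gamma> k * (1 / \<Gamma> k)) \<in> O(\<lambda>k. 1 * (1 / \<Gamma> k))"
    by (rule landau_o.big.mult) simp
  moreover have "\<epsilon> k / \<gamma> k * \<Gamma> k * (1 / \<Gamma> k) = \<epsilon> k / \<gamma> k" for k
    using \<Gamma>_pos[of k] by simp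
  ultimately show ?thesis by simp
qed

text \<open>Expanding the squared norm of \<open>s k\<close> around \<open>shat k\<close> leaves a
  mixed term linear in \<open>\<epsilon> k / \<gamma> k\<close>; it has the right order since
  \<open>exact_dist_bigo\<close> gives the rate \<open>1 / \<Gamma> k\<close> for the distance
  itself and not only for its square.\<close>

lemma norm_square_gap_bigo: "(\<lambda>k. (norm (s k))\<^sup>2 - (norm sbar)\<^sup>2) \<in> O(\<lambda>k. 1 / \<Gamma> k)"
proof -
  obtain R where R: "R \<ge> 0" "\<And>k. norm (shat k - sbar) \<le> R"
    using shat_bounded by blast
  define \<delta> where "\<delta> = (\<lambda>k. \<epsilon> k / \<gamma> k)"
  have \<delta>: "norm (s k - shat k) \<le> \<delta> k" for k
    using exact_dist by (simp add: \<delta>_def)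
  have \<delta>_bigo: "\<delta> \<in> O(\<lambda>k. 1 / \<Gamma> k)"
    using exact_dist_bigo by (simp add: \<delta>_def)
  have bound: "norm ((norm (s k))\<^sup>2 - (norm sbar)\<^sup>2)
      \<le> 1 * norm (gap k + 2 * ((norm sbar + R) * \<delta> k) + \<delta> k * \<delta> k)" for k
  proof -
    have "norm (shat k) \<le> norm sbar + R"
      using norm_triangle_ineq[of "shat k - sbar" sbar] R(2)[of k] by simp
    then have "2 * (shat k \<bullet> (s k - shat k)) \<le> 2 * ((norm sbar + R) * \<delta> k)"
      using norm_cauchy_schwarz[of "shat k" "s k - shat k"] \<delta>[of k]
        mult_mono[of "norm (shat k)" "norm sbar + R" "norm (s k - shat k)" "\<delta> k"] R(1) by simp
    moreover have "(norm (s k - shat k))\<^sup>2 \<le> \<delta> k * \<delta> k"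
      unfolding power2_eq_square using \<delta>[of k] by (intro mult_mono) (auto intro: order_trans[OF norm_ge_zero])
    moreover have "(norm (s k))\<^sup>2 = (norm (shat k))\<^sup>2 + 2 * (shat k \<bullet> (s k - shat k)) + (norm (s k - shat k))\<^sup>2"
      unfolding power2_norm_eq_inner by (simp add: inner_simps inner_commute)
    moreover have "0 \<le> (norm (s k))\<^sup>2 - (norm sbar)\<^sup>2"
      using norm_diff_sbar_le[of "s k" "v k"] iterate_mem closure_subset
      by (meson order_trans subsetD zero_le_power2)
    ultimately show ?thesis unfolding gap_def by simp
  qed
  have "\<delta> \<in> O(\<lambda>_. 1)"
    using landau_o.big_trans[OF \<delta>_bigo]
      bigoI_tendsto[of "\<lambda>k. 1 / \<Gamma> k" "\<lambda>_. 1" 0] inverse_\<Gamma>_tendsto by simp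
  then have "(\<lambda>k. \<delta> k * \<delta> k) \<in> O(\<lambda>k. 1 * (1 / \<Gamma> k))"
    by (rule landau_o.big.mult[OF _ \<delta>_bigo])
  then have sum: "(\<lambda>k. gap k + 2 * ((norm sbar + R) * \<delta> k) + \<delta> k * \<delta> k) \<in> O(\<lambda>k. 1 / \<Gamma> k)"
    using gap_bigo \<delta>_bigo by (intro sum_in_bigo) simp_all
  show ?thesis
    by (rule landau_o.big_trans[OF bigoI sum]) (rule always_eventually, rule allI, rule bound)
qed

lemma
  shows iterate_dist_bigo: "(\<lambda>k. norm (s k - sbar)) \<in> O(\<lambda>k. 1 / sqrt (\<Gamma> k))"
    and iterate_tendsto: "s \<longlonglongrightarrow> sbar"
proof -
  have "norm ((norm (s k - sbar))\<^sup>2) \<le> 1 * norm ((norm (s k))\<^sup>2 - (norm sbar)\<^sup>2)" for k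
    using norm_diff_sbar_le[of "s k" "v k"] iterate_mem closure_subset by force
  then have "(\<lambda>k. (norm (s k - sbar))\<^sup>2) \<in> O(\<lambda>k. 1 / \<Gamma> k)"
    by (intro landau_o.big_trans[OF bigoI norm_square_gap_bigo] always_eventually) blast
  then show "(\<lambda>k. norm (s k - sbar)) \<in> O(\<lambda>k. 1 / sqrt (\<Gamma> k))"
    using bigo_sqrt[of "\<lambda>k. norm (s k - sbar)" "\<lambda>k. 1 / \<Gamma> k"] \<Gamma>_pos
    by (simp add: real_sqrt_divide less_imp_le)
  moreover have "(\<lambda>k. 1 / sqrt (\<Gamma> k)) \<longlonglongrightarrow> 0"
    using tendsto_real_sqrt[OF inverse_\<Gamma>_tendsto] by (simp add: real_sqrt_divide)
  ultimately have "(\<lambda>k. norm (s k - sbar)) \<longlonglongrightarrow> 0"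
    by (rule bigo_tendsto_zero)
  then show "s \<longlonglongrightarrow> sbar"
    using LIM_zero_cancel tendsto_norm_zero_iff by blast
qed

lemma exact_dist_tendsto: "(\<lambda>k. \<epsilon> k / \<gamma> k) \<longlonglongrightarrow> 0"
  using exact_dist_bigo inverse_\<Gamma>_tendsto by (rule bigo_tendsto_zero)

text \<open>Passing from exact points to iterates adds a multiple of \<open>\<gamma> k * (\<delta>
  k)\<^sup>2 = \<delta> k * \<epsilon> k\<close>, which is summable because \<open>\<delta>\<close>
  is bounded.\<close>

lemma weighted_dist_summable: "summable (\<lambda>k. \<gamma> k * (norm (s k - sbar))\<^sup>2)"
proof -
  define \<delta> where "\<delta> = (\<lambda>k. \<epsilon> k / \<gamma> k)"
  have "Bseq \<delta>"
    using exact_dist_tendsto unfolding \<delta>_def by (intro convergent_imp_Bseq convergentI)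
  then obtain D where D: "\<And>k. norm (\<delta> k) \<le> D"
    by (auto simp: Bseq_def)
  have "norm (\<gamma> k * (norm (s k - sbar))\<^sup>2) \<le> 2 * (\<gamma> k * gap k) + 2 * D * \<epsilon> k" for k
  proof -
    let ?a = "norm (shat k - sbar)"
    have \<delta>: "norm (s k - shat k) \<le> \<delta> k"
      using exact_dist by (simp add: \<delta>_def)
    have "norm (s k - sbar) \<le> ?a + \<delta> k"
      using norm_triangle_ineq[of "shat k - sbar" "s k - shat k"] \<delta> by simp
    then have "(norm (s k - sbar))\<^sup>2 \<le> (?a + \<delta> k)\<^sup>2"
      by (intro power_mono) auto
    also have "\<dots> \<le> 2 * ?a\<^sup>2 + 2 * (\<delta> k)\<^sup>2"
      using sum_squares_bound[of ?a "\<delta> k"] by (simp add: power2_sum)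
    also have "\<dots> \<le> 2 * gap k + 2 * (\<delta> k)\<^sup>2"
      using gap_ge[of k] by simp
    finally have "\<gamma> k * (norm (s k - sbar))\<^sup>2 \<le> \<gamma> k * (2 * gap k + 2 * (\<delta> k)\<^sup>2)"
      using step_pos[of k] by (intro mult_left_mono) auto
    also have "\<dots> = 2 * (\<gamma> k * gap k) + 2 * (\<delta> k * \<epsilon> k)"
      using step_pos[of k] by (simp add: \<delta>_def power2_eq_square algebra_simps)
    also have "\<dots> \<le> 2 * (\<gamma> k * gap k) + 2 * D * \<epsilon> k"
      using mult_right_mono[OF _ error_nonneg, of "\<delta> k" D k] D[of k] by simp
    finally show ?thesis using step_pos[of k] by simp
  qed
  moreover have "summable (\<lambda>k. 2 * (\<gamma> k * gap k) + 2 * D * \<epsilon> k)"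
    by (intro summable_add summable_mult weighted_gap_summable error_summable)
  ultimately show ?thesis
    by (blast intro: summable_comparison_test')
qed

section \<open>Asymptotic upper bound for the objective values\<close>

lemma multiplier_eq: "\<Lambda> (Suc k) = \<Lambda> 0 - (\<Sum>i\<le>k. \<gamma> i *\<^sub>R (s i - sbar)) - \<Gamma> k *\<^sub>R sbar"
proof (induction k)
  case 0
  show ?case by (simp add: multiplier_Suc \<Gamma>_def algebra_simps)
next
  case (Suc k)
  show ?case
    by (subst multiplier_Suc, subst Suc.IH) (simp add: \<Gamma>_def algebra_simps)
qed

text \<open>
  The divergent part \<open>- \<Gamma> k *\<^sub>R sbar\<close> of the multipliers contributes with a favourable sign,
  because \<open>sbar \<bullet> (s k - sbar) \<ge> 0\<close>; the rest is \<open>o(sqrt (\<Gamma> k))\<close>, against a distance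
  \<open>O(1 / sqrt (\<Gamma> k))\<close>.
\<close>

lemma value_eventually_le:
  assumes "e > 0"
  shows "\<forall>\<^sub>F k in sequentially. v k \<le> rbar + e"
proof -
  define u where "u = (\<lambda>k. norm (s k - sbar))"
  define W where "W = (\<lambda>k. \<Sum>i\<le>k. \<gamma> i * u i)"
  define bnd where "bnd = (\<lambda>k. norm (\<Lambda> 0) * u k + W k * u k + \<epsilon> k * u k + \<epsilon> k * (\<epsilon> k / \<gamma> k) / 2)"
  have v_le: "v k \<le> rbar + bnd k" for k
  proof -
    have mem: "(s k, v k) \<in> closure M"
      using iterate_mem closure_subset by blast
    have "\<mu> k \<bullet> (s k - sbar) = (\<mu> k - \<Lambda> (Suc k)) \<bullet> (s k - sbar) + \<Lambda> 0 \<bullet> (s k - sbar)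
        - (\<Sum>i\<le>k. \<gamma> i *\<^sub>R (s i - sbar)) \<bullet> (s k - sbar) - \<Gamma> k * (sbar \<bullet> (s k - sbar))"
      by (simp add: multiplier_eq inner_diff_left)
    moreover have "(\<mu> k - \<Lambda> (Suc k)) \<bullet> (s k - sbar) \<le> \<epsilon> k * u k"
      using norm_cauchy_schwarz[of "\<mu> k - \<Lambda> (Suc k)" "s k - sbar"]
        mult_right_mono[OF multiplier_dist[of k] norm_ge_zero[of "s k - sbar"]]
      by (simp add: u_def)
    moreover have "\<Lambda> 0 \<bullet> (s k - sbar) \<le> norm (\<Lambda> 0) * u k"
      unfolding u_def by (rule norm_cauchy_schwarz)
    moreover have "- ((\<Sum>i\<le>k. \<gamma> i *\<^sub>R (s i - sbar)) \<bullet> (s k - sbar)) \<le> W k * u k"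
    proof -
      have "norm (\<Sum>i\<le>k. \<gamma> i *\<^sub>R (s i - sbar)) \<le> W k"
        unfolding W_def u_def using step_pos by (intro sum_norm_le) (simp add: less_imp_le)
      from mult_right_mono[OF this norm_ge_zero[of "s k - sbar"]] show ?thesis
        using Cauchy_Schwarz_ineq2[of "\<Sum>i\<le>k. \<gamma> i *\<^sub>R (s i - sbar)" "s k - sbar"]
        unfolding u_def by linarith
    qed
    moreover have "0 \<le> \<Gamma> k * (sbar \<bullet> (s k - sbar))"
      using obtuse[OF mem] \<Gamma>_pos[of k] by (simp add: less_imp_le)
    \<comment> \<open>\<open>rhat k\<close> cancels between \<open>value_le\<close> and the
      subgradient inequality at \<open>(sbar, rbar)\<close>.\<close>
    moreover have "v k \<le> rbar + \<mu> k \<bullet> (s k - sbar) + (\<epsilon> k)\<^sup>2 / (2 * \<gamma> k)"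
      using value_le[of k] subgradient[OF sbar_closure, of k] by (simp add: inner_simps)
    moreover have "(\<epsilon> k)\<^sup>2 / (2 * \<gamma> k) = \<epsilon> k * (\<epsilon> k / \<gamma> k) / 2"
      by (simp add: power2_eq_square)
    ultimately show ?thesis unfolding bnd_def by linarith
  qed
  have u0: "u \<longlonglongrightarrow> 0"
    unfolding u_def by (intro tendsto_norm_zero LIM_zero iterate_tendsto)
  have "W \<in> o(\<lambda>k. sqrt (\<Gamma> k))"
    unfolding W_def \<Gamma>_def u_def
    by (intro weighted_sum_smallo_sqrt step_pos norm_ge_zero weighted_dist_summable step_sum)
  moreover have "u \<in> O(\<lambda>k. 1 / sqrt (\<Gamma> k))"
    unfolding u_def by (rule iterate_dist_bigo)
  ultimately have "(\<lambda>k. W k * u k) \<in> o(\<lambda>k. sqrt (\<Gamma> k) * (1 / sqrt (\<Gamma> k)))"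
    by (rule landau_o.small_big_mult)
  moreover have "sqrt (\<Gamma> k) * (1 / sqrt (\<Gamma> k)) = 1" for k
    using \<Gamma>_pos[of k] by simp
  ultimately have Wu: "(\<lambda>k. W k * u k) \<longlonglongrightarrow> 0"
    using smalloD_tendsto[of "\<lambda>k. W k * u k" sequentially "\<lambda>_. 1"] by simp
  have "bnd \<longlonglongrightarrow> norm (\<Lambda> 0) * 0 + 0 + 0 * 0 + 0 * 0 / 2"
    unfolding bnd_def
    by (intro tendsto_intros u0 Wu summable_LIMSEQ_zero[OF error_summable] exact_dist_tendsto) simp
  then have "\<forall>\<^sub>F k in sequentially. bnd k < e"
    using assms by (intro order_tendstoD) auto
  then show ?thesis
  proof eventually_elim
    case (elim k)
    with v_le[of k] show ?case by linarith
  qed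
qed

end

subsection \<open>The inexact augmented Lagrangian method\<close>

locale ialm =
  fixes X :: "'a::real_normed_vector set"
    and K :: "'b::{real_inner, complete_space} set"
    and f :: "'a \<Rightarrow> ereal" and C :: "'a \<Rightarrow> 'b"
    and \<gamma> \<epsilon> :: "nat \<Rightarrow> real"
    and x :: "nat \<Rightarrow> 'a" and y \<Lambda> s :: "nat \<Rightarrow> 'b"
  assumes K: "K \<noteq> {}" "closed K" "convex K"
    and f_convex: "closed_proper_convex X f"
    and graph: "convex (constraint_graph X K C)"
    and conditions: "ialm_conditions \<gamma> \<epsilon>"
    and iteration: "ialm_sequence X K f C \<gamma> \<epsilon> x y \<Lambda> s"
begin

definition "S = attainable_violations X K C"
definition "\<nu> = value_fun X K f C"
definition "sbar = min_violation X K C"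
text \<open>Lies between the strict epigraph and the epigraph of \<open>\<nu>\<close>; the two can
  differ from it because the infimum in \<open>\<nu>\<close> need not be attained.\<close>

definition "M = {(t, r). \<exists>w\<in>X. (w, t) \<in> constraint_graph X K C \<and> f w \<le> ereal r}"
text \<open>The indices are shifted: step \<open>k\<close> of the method produces \<open>x (Suc k)\<close> and \<open>s (Suc k)\<close>.\<close>

definition "v k = real_of_ereal (f (x (Suc k)))"

section \<open>Reduction of the method to inexact proximal steps\<close>

lemma iterate_simps:
  "x (Suc k) \<in> X" "y (Suc k) \<in> K" "s (Suc k) = C (x (Suc k)) - y (Suc k)"
  "(x (Suc k), s (Suc k)) \<in> constraint_graph X K C"
  using iteration by (auto simp: ialm_sequence_def constraint_graph_def)

lemma value_le: "(w, t) \<in> constraint_graph X K C \<Longrightarrow> \<nu> t \<le> f w"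
  unfolding \<nu>_def value_fun_def constraint_graph_def by (intro INF_lower) force

lemma mem_M_if_value_less:
  assumes "\<nu> t < ereal r"
  shows "(t, r) \<in> M"
proof -
  obtain w where w: "w \<in> X" "C w \<in> (\<lambda>k. k + t) ` K" "f w < ereal r"
    using assms unfolding \<nu>_def value_fun_def by (auto simp: INF_less_iff)
  from w(2) obtain k where "k \<in> K" "t = C w - k"
    by auto
  with w show ?thesis
    unfolding M_def constraint_graph_def by (auto intro!: bexI[of _ w] less_imp_le)
qed

lemma convex_S: "convex S"
proof -
  have "S = snd ` constraint_graph X K C"
    by (force simp: S_def attainable_violations_def constraint_graph_def)
  then show ?thesis
    using convex_linear_image[OF linear_snd graph] by simp
qed

text \<open>\<open>sbar\<close> is the projection of the origin onto the closed convex set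
  \<open>closure S\<close>; the second claim is the variational inequality of this
  projection.\<close>

lemma
  shows sbar_le: "t \<in> S \<Longrightarrow> norm sbar \<le> norm t"
    and sbar_obtuse: "t \<in> S \<Longrightarrow> 0 \<le> sbar \<bullet> (t - sbar)"
proof -
  have "S \<noteq> {}"
    using iterate_simps unfolding S_def attainable_violations_def by blast
  then have closure: "closure S \<noteq> {}" "closed (closure S)" "convex (closure S)"
    using convex_S by simp_all
  have "sbar = arg_min_on (\<lambda>t. norm (0 - t)) (closure S)"
    by (simp add: sbar_def min_violation_def S_def)
  note * = arg_min_on_dist[OF closure, where z = 0, folded this]
  have min: "sbar \<in> closure S" "\<And>t. t \<in> closure S \<Longrightarrow> norm sbar \<le> norm t"
    using *(1) *(2) by simp_all
  show "norm sbar \<le> norm t" if "t \<in> S" for t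
    using min(2) closure_subset that by blast
  show "0 \<le> sbar \<bullet> (t - sbar)" if "t \<in> S" for t
  proof -
    have "t \<in> closure S"
      using closure_subset that by blast
    then have "(0 - sbar) \<bullet> (t - sbar) \<le> 0"
      using min by (intro any_closest_point_dot[OF closure(3,2)]) simp_all
    then show ?thesis by simp
  qed
qed

lemma convex_M: "convex M"
  unfolding convex_alt
proof (intro ballI allI impI)
  fix p q :: "'b \<times> real" and u :: real
  assume pq: "p \<in> M" "q \<in> M" and u: "0 \<le> u \<and> u \<le> 1"
  show "(1 - u) *\<^sub>R p + u *\<^sub>R q \<in> M"
  \<comment> \<open>\<open>closed_proper_convex\<close> gives the convexity inequality only for
    weights strictly between 0 and 1.\<close>
  proof (cases "u = 0 \<or> u = 1")
    case True
    then show ?thesis using pq by auto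
  next
    case False
    obtain w t r w' t' r' where p: "p = (t, r)" "w \<in> X" "(w, t) \<in> constraint_graph X K C" "f w \<le> ereal r"
      and q: "q = (t', r')" "w' \<in> X" "(w', t') \<in> constraint_graph X K C" "f w' \<le> ereal r'"
      using pq unfolding M_def by blast
    let ?w = "(1 - u) *\<^sub>R w + u *\<^sub>R w'"
    have mem: "(?w, (1 - u) *\<^sub>R t + u *\<^sub>R t') \<in> constraint_graph X K C"
      using convexD_alt[OF graph p(3) q(3)] u by simp
    have "f ?w \<le> ereal (1 - u) * f w + ereal u * f w'"
      using f_convex p(2) q(2) u False unfolding closed_proper_convex_def by auto
    also have "\<dots> \<le> ereal (1 - u) * ereal r + ereal u * ereal r'"
      using p(4) q(4) u by (intro add_mono ereal_mult_left_mono) auto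
    finally have "f ?w \<le> ereal ((1 - u) * r + u * r')" by simp
    then show ?thesis
      using mem unfolding M_def p(1) q(1) by (auto simp: constraint_graph_def intro!: bexI[of _ ?w])
  qed
qed

lemma
  shows f_iterate: "f (x (Suc k)) = ereal (v k)"
    and iterate_approx_min: "(t, r) \<in> M \<Longrightarrow> v k - \<Lambda> k \<bullet> s (Suc k) + \<gamma> k / 2 * (norm (s (Suc k)))\<^sup>2
      \<le> r - \<Lambda> k \<bullet> t + \<gamma> k / 2 * (norm t)\<^sup>2 + (\<epsilon> (Suc k))\<^sup>2 / (2 * \<gamma> k)"
proof -
  define L where "L = aug_lagrangian f (\<gamma> k) (x (Suc k)) (s (Suc k)) (\<Lambda> k)"
  define I where "I = (INF (w, t)\<in>constraint_graph X K C. aug_lagrangian f (\<gamma> k) w t (\<Lambda> k))"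
  define \<eta> where "\<eta> = (\<epsilon> (Suc k))\<^sup>2 / (2 * \<gamma> k)"
  have LI: "L - I \<le> ereal \<eta>"
    using iteration unfolding ialm_sequence_def L_def I_def \<eta>_def by blast
  have "f (x (Suc k)) \<noteq> - \<infinity>"
    using f_convex iterate_simps unfolding closed_proper_convex_def by blast
  \<comment> \<open>Otherwise \<open>L - I\<close> would be \<open>\<infinity>\<close> whatever
    \<open>I\<close> is, since \<open>\<infinity> - \<infinity> = \<infinity>\<close> in
    \<open>ereal\<close>.\<close>
  moreover have "f (x (Suc k)) \<noteq> \<infinity>"
    using LI by (auto simp: L_def aug_lagrangian_def)
  ultimately show fin: "f (x (Suc k)) = ereal (v k)"
    unfolding v_def by (cases "f (x (Suc k))") simp_all
  show "v k - \<Lambda> k \<bullet> s (Suc k) + \<gamma> k / 2 * (norm (s (Suc k)))\<^sup>2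
      \<le> r - \<Lambda> k \<bullet> t + \<gamma> k / 2 * (norm t)\<^sup>2 + (\<epsilon> (Suc k))\<^sup>2 / (2 * \<gamma> k)"
    if mem: "(t, r) \<in> M"
  proof -
    obtain w where w: "(w, t) \<in> constraint_graph X K C" "f w \<le> ereal r"
      using mem by (auto simp: M_def)
    have "I \<le> aug_lagrangian f (\<gamma> k) w t (\<Lambda> k)"
      unfolding I_def using w(1) by (intro INF_lower2[of "(w, t)"]) auto
    also have "\<dots> \<le> ereal (r - \<Lambda> k \<bullet> t + \<gamma> k / 2 * (norm t)\<^sup>2)"
      using w(2) unfolding aug_lagrangian_def by (cases "f w") auto
    finally have "I \<le> ereal (r - \<Lambda> k \<bullet> t + \<gamma> k / 2 * (norm t)\<^sup>2)" .
    moreover have "L = ereal (v k - \<Lambda> k \<bullet> s (Suc k) + \<gamma> k / 2 * (norm (s (Suc k)))\<^sup>2)"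
      by (simp add: L_def aug_lagrangian_def fin)
    \<comment> \<open>\<open>I\<close> is real: \<open>-\<infinity>\<close> would make
      \<open>L - I\<close> infinite, and \<open>\<infinity>\<close> is excluded by the bound just
      derived.\<close>
    ultimately show ?thesis
      using LI unfolding \<eta>_def[symmetric] by (cases I) auto
  qed
qed

lemma proximal:
  assumes "(sbar, rbar) \<in> closure M"
  shows "inexact_proximal M sbar rbar \<gamma> (\<lambda>k. \<epsilon> (Suc k)) v (\<lambda>k. s (Suc k)) \<Lambda>"
proof
  show "(s (Suc k), v k) \<in> M" for k
    using iterate_simps f_iterate unfolding M_def by force
  show "\<Lambda> (Suc k) = \<Lambda> k - \<gamma> k *\<^sub>R s (Suc k)" for k
    using iteration by (simp add: ialm_sequence_def)
  show "0 \<le> sbar \<bullet> (t - sbar)" if "(t, r) \<in> M" for t r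
    using that sbar_obtuse by (auto simp: M_def S_def attainable_violations_def)
  show "filterlim (\<lambda>k. \<Sum>i\<le>k. \<gamma> i) at_top sequentially"
    using conditions filterlim_sequentially_Suc[of "\<lambda>n. \<Sum>k<n. \<gamma> k" at_top]
    by (simp add: ialm_conditions_def lessThan_Suc_atMost)
qed (use convex_M iterate_approx_min assms conditions in
      \<open>simp_all add: ialm_conditions_def lessThan_Suc_atMost\<close>)

text \<open>The angle at the projection \<open>p\<close> of \<open>z = C (x (Suc k))\<close> is
  obtuse, and \<open>z - p\<close> is itself an attainable violation, hence no shorter than
  \<open>sbar\<close>. The excess squared norm of the iterate thus controls both rates.\<close>

lemma projection_dist:
  "(norm (y (Suc k) - metric_proj K (C (x (Suc k)))))\<^sup>2 \<le> (norm (s (Suc k)))\<^sup>2 - (norm sbar)\<^sup>2"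
proof -
  define z p where "z = C (x (Suc k))" and "p = metric_proj K z"
  have p: "p \<in> K" "\<And>w. w \<in> K \<Longrightarrow> norm (z - p) \<le> norm (z - w)"
    unfolding p_def metric_proj_def by (fact arg_min_on_dist[OF K])+
  have "(z - p) \<bullet> (y (Suc k) - p) \<le> 0"
    using any_closest_point_dot[OF K(3,2) p(1) iterate_simps(2)] p(2) by (simp add: dist_norm)
  moreover have "(norm (s (Suc k)))\<^sup>2
      = (norm (z - p))\<^sup>2 - 2 * ((z - p) \<bullet> (y (Suc k) - p)) + (norm (y (Suc k) - p))\<^sup>2"
    unfolding iterate_simps z_def[symmetric] power2_norm_eq_inner
    by (simp add: inner_simps inner_commute)
  moreover have "z - p \<in> S"
    using p(1) iterate_simps(1) unfolding S_def attainable_violations_def constraint_graph_def z_def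
    by auto
  then have "(norm sbar)\<^sup>2 \<le> (norm (z - p))\<^sup>2"
    using sbar_le by (simp add: power_mono)
  ultimately show ?thesis
    unfolding p_def z_def by linarith
qed

lemma
  assumes "(sbar, rbar) \<in> closure M"
  shows violation_bigo: "(\<lambda>k. norm (C (x k) - y k - sbar)) \<in> O(\<lambda>k. 1 / sqrt (\<Sum>i<k. \<gamma> i))"
    and projection_bigo: "(\<lambda>k. norm (y k - metric_proj K (C (x k)))) \<in> O(\<lambda>k. 1 / sqrt (\<Sum>i<k. \<gamma> i))"
    and violation_tendsto: "(\<lambda>k. C (x k) - y k) \<longlonglongrightarrow> sbar"
    and projection_tendsto: "(\<lambda>k. norm (y k - metric_proj K (C (x k)))) \<longlonglongrightarrow> 0"
proof -
  interpret inexact_proximal M sbar rbar \<gamma> "\<lambda>k. \<epsilon> (Suc k)" v "\<lambda>k. s (Suc k)" \<Lambda>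
    using assms by (rule proximal)
  have \<Gamma>_eq: "\<Gamma> k = (\<Sum>i<Suc k. \<gamma> i)" for k
    by (simp add: \<Gamma>_def lessThan_Suc_atMost)
  show "(\<lambda>k. norm (C (x k) - y k - sbar)) \<in> O(\<lambda>k. 1 / sqrt (\<Sum>i<k. \<gamma> i))"
    using iterate_dist_bigo unfolding \<Gamma>_eq iterate_simps by (rule bigo_Suc_imp_bigo)
  show "(\<lambda>k. C (x k) - y k) \<longlonglongrightarrow> sbar"
    using iterate_tendsto unfolding iterate_simps by (subst (asm) filterlim_sequentially_Suc)
  let ?d = "\<lambda>k. norm (y (Suc k) - metric_proj K (C (x (Suc k))))"
  have "norm ((?d k)\<^sup>2) \<le> 1 * norm ((norm (s (Suc k)))\<^sup>2 - (norm sbar)\<^sup>2)" for k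
    using projection_dist[of k] by simp
  then have "(\<lambda>k. (?d k)\<^sup>2) \<in> O(\<lambda>k. 1 / \<Gamma> k)"
    by (intro landau_o.big_trans[OF bigoI norm_square_gap_bigo] always_eventually) blast
  then have d: "?d \<in> O(\<lambda>k. 1 / sqrt (\<Gamma> k))"
    using bigo_sqrt[of ?d "\<lambda>k. 1 / \<Gamma> k"] \<Gamma>_pos
    by (simp add: real_sqrt_divide less_imp_le)
  then show "(\<lambda>k. norm (y k - metric_proj K (C (x k)))) \<in> O(\<lambda>k. 1 / sqrt (\<Sum>i<k. \<gamma> i))"
    unfolding \<Gamma>_eq by (rule bigo_Suc_imp_bigo)
  have "(\<lambda>k. 1 / sqrt (\<Gamma> k)) \<longlonglongrightarrow> 0"
    using tendsto_real_sqrt[OF inverse_\<Gamma>_tendsto] by (simp add: real_sqrt_divide)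
  with d have "?d \<longlonglongrightarrow> 0" by (rule bigo_tendsto_zero)
  then show "(\<lambda>k. norm (y k - metric_proj K (C (x k)))) \<longlonglongrightarrow> 0"
    by (subst (asm) filterlim_sequentially_Suc)
qed

lemma objective_eventually_le:
  assumes "(sbar, rbar) \<in> closure M" "e > 0"
  shows "\<forall>\<^sub>F k in sequentially. f (x k) \<le> ereal (rbar + e)"
proof -
  interpret inexact_proximal M sbar rbar \<gamma> "\<lambda>k. \<epsilon> (Suc k)" v "\<lambda>k. s (Suc k)" \<Lambda>
    using assms(1) by (rule proximal)
  have "\<forall>\<^sub>F k in sequentially. f (x (Suc k)) \<le> ereal (rbar + e)"
    using value_eventually_le[OF assms(2)] by (simp add: f_iterate)
  then show ?thesis
    by (subst (asm) eventually_sequentially_Suc)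
qed

section \<open>The two directions of the equivalence\<close>

lemma lsc_if_simply_converges:
  assumes "simply_converges X K f C x y"
  shows "lsc_at \<nu> sbar UNIV"
proof (rule ccontr)
  assume "\<not> lsc_at \<nu> sbar UNIV"
  then have *: "Liminf (at sbar) \<nu> < \<nu> sbar"
    by (simp add: lsc_at_def not_le)
  have lim: "(\<lambda>k. f (x k)) \<longlonglongrightarrow> \<nu> sbar"
    using assms by (simp add: simply_converges_def Let_def \<nu>_def sbar_def)
  obtain r where r: "Liminf (at sbar) \<nu> < ereal r" "ereal r < \<nu> sbar"
    using ereal_dense2[OF *] by blast
  \<comment> \<open>\<open>r'\<close> leaves room for the slack in
    \<open>objective_eventually_le\<close> while staying below \<open>\<nu> sbar\<close>.\<close>
  obtain r' where r': "ereal r < ereal r'" "ereal r' < \<nu> sbar"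
    using ereal_dense2[OF r(2)] by blast
  have freq: "\<exists>\<^sub>F t in at sbar. \<nu> t < ereal r"
  proof (rule ccontr)
    assume "\<not> ?thesis"
    then have "\<forall>\<^sub>F t in at sbar. ereal r \<le> \<nu> t"
      by (simp add: not_frequently not_less)
    then have "ereal r \<le> Liminf (at sbar) \<nu>"
      by (rule Liminf_bounded)
    with r(1) show False by simp
  qed
  \<comment> \<open>Points \<open>t\<close> near \<open>sbar\<close> with value below
    \<open>r\<close> put \<open>(t, r)\<close> in \<open>M\<close>, at the same height
    \<open>r\<close>.\<close>
  have "(sbar, r) \<in> closure M"
    unfolding closure_approachable
  proof (intro allI impI)
    fix e :: real assume "e > 0"
    then obtain t where "dist t sbar < e" "\<nu> t < ereal r"
      using freq unfolding frequently_at by blast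
    then show "\<exists>z\<in>M. dist z (sbar, r) < e"
      using mem_M_if_value_less by (intro bexI[of _ "(t, r)"]) (auto simp: dist_Pair_Pair)
  qed
  then have "\<forall>\<^sub>F k in sequentially. f (x k) \<le> ereal (r + (r' - r))"
    using r' by (intro objective_eventually_le) auto
  then have "\<nu> sbar \<le> ereal r'"
    using lim by (intro tendsto_upperbound[of "\<lambda>k. f (x k)"]) auto
  with r'(2) show False by simp
qed

lemma semi_quantitatively_converges_if_lsc:
  assumes lsc: "lsc_at \<nu> sbar UNIV" and finite: "\<bar>\<nu> sbar\<bar> \<noteq> \<infinity>"
  shows "semi_quantitatively_converges X K f C \<gamma> x y"
proof -
  obtain p where p: "\<nu> sbar = ereal p"
    using finite by auto
  \<comment> \<open>\<open>(sbar, p)\<close> may lie outside \<open>M\<close> when the infimum is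
    not attained; raising the height by \<open>e / 2\<close> gives a point of
    \<open>M\<close>.\<close>
  have mem: "(sbar, p) \<in> closure M"
    unfolding closure_approachable
  proof (intro allI impI)
    fix e :: real assume "e > 0"
    then show "\<exists>z\<in>M. dist z (sbar, p) < e"
      using mem_M_if_value_less[of sbar "p + e / 2"] p
      by (intro bexI[of _ "(sbar, p + e / 2)"]) (auto simp: dist_Pair_Pair dist_real_def)
  qed
  have "(\<lambda>k. f (x k)) \<longlonglongrightarrow> \<nu> sbar"
  proof (rule order_tendstoI)
    fix a assume a: "a < \<nu> sbar"
    have "\<forall>\<^sub>F t in at sbar. a < \<nu> t"
      using lsc a by (simp add: lsc_at_def le_Liminf_iff)
    \<comment> \<open>\<open>lsc_at\<close> concerns the punctured neighbourhood; the centre is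
      added because a violation may equal \<open>sbar\<close>.\<close>
    then have "\<forall>\<^sub>F t in nhds sbar. a < \<nu> t"
      using a by (simp add: eventually_nhds_conv_at)
    then have "\<forall>\<^sub>F k in sequentially. a < \<nu> (C (x k) - y k)"
      using violation_tendsto[OF mem] by (rule eventually_compose_filterlim)
    \<comment> \<open>The comparison of \<open>\<nu>\<close> with \<open>f\<close> holds from index
      1 on, as \<open>x 0\<close> and \<open>y 0\<close> are arbitrary.\<close>
    then have "\<forall>\<^sub>F k in sequentially. a < \<nu> (C (x (Suc k)) - y (Suc k))"
      by (subst eventually_sequentially_Suc)
    then have "\<forall>\<^sub>F k in sequentially. a < f (x (Suc k))"
      by eventually_elim
        (use value_le[OF iterate_simps(4)] in \<open>simp add: iterate_simps(3) less_le_trans\<close>)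
    then show "\<forall>\<^sub>F k in sequentially. a < f (x k)"
      by (subst (asm) eventually_sequentially_Suc)
  next
    fix a assume "\<nu> sbar < a"
    then obtain c where c: "p < c" "ereal c < a"
      using ereal_dense2[of "\<nu> sbar" a] p by auto
    then have "\<forall>\<^sub>F k in sequentially. f (x k) \<le> ereal (p + (c - p))"
      by (intro objective_eventually_le mem) simp
    then show "\<forall>\<^sub>F k in sequentially. f (x k) < a"
      by eventually_elim (use c in \<open>simp add: le_less_trans\<close>)
  qed
  then show ?thesis
    using finite violation_bigo[OF mem] projection_bigo[OF mem]
      violation_tendsto[OF mem] projection_tendsto[OF mem]
    by (simp add: semi_quantitatively_converges_def simply_converges_def Let_def \<nu>_def sbar_def)
qed

end

theorem corollary3p3:
  fixes X :: "'a::{real_inner, complete_space} set"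
    and K :: "'b::{real_inner, complete_space} set"
    and f :: "'a \<Rightarrow> ereal" and C :: "'a \<Rightarrow> 'b"
    and \<gamma> \<epsilon> :: "nat \<Rightarrow> real"
    and x :: "nat \<Rightarrow> 'a" and y \<Lambda> s :: "nat \<Rightarrow> 'b"
  defines "\<nu> \<equiv> value_fun X K f C"
    and "sbar \<equiv> min_violation X K C"
  assumes "X \<noteq> {}" "closed X" "convex X"
    and "K \<noteq> {}" "closed K" "convex K"
    and "closed_proper_convex X f"
    and "closed (constraint_graph X K C)" "convex (constraint_graph X K C)"
        "constraint_graph X K C \<noteq> {}"
    and "\<forall>t. \<nu> t > -\<infinity>"
    and "ialm_conditions \<gamma> \<epsilon>"
    and "ialm_sequence X K f C \<gamma> \<epsilon> x y \<Lambda> s"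
  shows "(simply_converges X K f C x y \<longleftrightarrow> lsc_at \<nu> sbar UNIV \<and> \<bar>\<nu> sbar\<bar> \<noteq> \<infinity>) \<and>
         (lsc_at \<nu> sbar UNIV \<and> \<nu> sbar < \<infinity> \<longrightarrow> semi_quantitatively_converges X K f C \<gamma> x y)"
proof -
  interpret I: ialm X K f C \<gamma> \<epsilon> x y \<Lambda> s
    using assms by unfold_locales
  have defs: "I.\<nu> = \<nu>" "I.sbar = sbar"
    by (simp_all add: I.\<nu>_def I.sbar_def assms(1,2))
  have "lsc_at \<nu> sbar UNIV \<and> \<bar>\<nu> sbar\<bar> \<noteq> \<infinity>" if "simply_converges X K f C x y"
    using I.lsc_if_simply_converges[OF that] that
    by (simp add: simply_converges_def Let_def defs assms(1,2))
  moreover have "semi_quantitatively_converges X K f C \<gamma> x y"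
    if "lsc_at \<nu> sbar UNIV" "\<bar>\<nu> sbar\<bar> \<noteq> \<infinity>"
    using I.semi_quantitatively_converges_if_lsc that by (simp add: defs)
  moreover have "simply_converges X K f C x y" if "semi_quantitatively_converges X K f C \<gamma> x y"
    using that by (simp add: semi_quantitatively_converges_def)
  \<comment> \<open>Properness of \<open>\<nu>\<close> excludes \<open>-\<infinity>\<close>.\<close>
  moreover have "\<bar>\<nu> sbar\<bar> \<noteq> \<infinity>" if "\<nu> sbar < \<infinity>"
    using that assms(13)[rule_format, of sbar] by auto
  ultimately show ?thesis by metis
qed

end
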